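(* Let $T$ be a tree on $n\geq 8$ vertices. Let $k$ and $i$ be integers with $0\leq i\leq 2k$ and $2n-1=k^2+i$. For any leaf $u$ of $T$, \[\frac{\operatorname{Ecc}(T)}{\operatorname{ecc}_T(u)} \leq \begin{cases} 2n+1-2k-\frac{i}{k} & \text{if } 0\leq i\leq k,\\ 2n+1-2k-\frac{i+1}{k+1} & \text{if } k+1\leq i\leq 2k.\end{cases}\] Equality holds if and only if $T$ has a longest path $P=z_1z_2\ldots z_{2x-1}$ (where $x=k$ in the first case and $x=k+1$ in the second case), the leaf $u$ is adjacent to $z_x$, and every other vertex not on $P$ is adjacent to either $z_2$ or $z_{2x-2}$. For $i=k$ the two bounds agree and both values of $x$ give an extremal tree.
   Context: For a vertex $v$ of a tree $T$, $\operatorname{ecc}_T(v)=\max_{w\in V(T)} d_T(v,w)$. The total eccentricity is $\operatorname{Ecc}(T)=\sum_{z\in V(T)}\operatorname{ecc}_T(z)$. A leaf is a vertex of degree 1. *)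

theory Defs
  imports Complex_Main "Graph_Theory.Graph_Theory"
begin

text \<open>
  Finite simple undirected graphs are the symmetric digraphs without loops and parallel arcs
  of the locale \<^locale>\<open>graph\<close>. The library predicate \<^const>\<open>tree\<close> forbids
  every directed cycle, hence also the back-and-forth walk along a single edge. In such a graph
  the cycles of the undirected graph are exactly the directed cycles of length at least 3.
\<close>

definition undirected_tree :: "('a, 'b) pre_digraph \<Rightarrow> bool" where
  "undirected_tree T \<longleftrightarrow>
     graph T \<and> connected T \<and> \<not> (\<exists>p. pre_digraph.cycle T p \<and> 3 \<le> length p)"

definition leaf :: "('a, 'b) pre_digraph \<Rightarrow> 'a \<Rightarrow> bool" where
  "leaf T v \<longleftrightarrow> v \<in> verts T \<and> out_degree T v = 1"

text \<open>
  The distance is the library's shortest-path cost for unit arc weights. It is finite between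
  any two vertices of a connected graph, so the conversion to real numbers loses nothing there.
\<close>

definition gdist :: "('a, 'b) pre_digraph \<Rightarrow> 'a \<Rightarrow> 'a \<Rightarrow> real" where
  "gdist T v w = real_of_ereal (wf_digraph.\<mu> T (\<lambda>_. 1) v w)"

definition ecc :: "('a, 'b) pre_digraph \<Rightarrow> 'a \<Rightarrow> real" where
  "ecc T v = Max (gdist T v ` verts T)"

definition total_ecc :: "('a, 'b) pre_digraph \<Rightarrow> real" where
  "total_ecc T = (\<Sum>z\<in>verts T. ecc T z)"

definition longest_path :: "('a, 'b) pre_digraph \<Rightarrow> 'a list \<Rightarrow> bool" where
  "longest_path T P \<longleftrightarrow> vpath P T \<and> (\<forall>Q. vpath Q T \<longrightarrow> length Q \<le> length P)"

text \<open>Lists are indexed from 0: the vertex $z_j$ of the path is \<open>P ! (j - 1)\<close>.\<close>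

definition extremal_config :: "('a, 'b) pre_digraph \<Rightarrow> 'a \<Rightarrow> nat \<Rightarrow> bool" where
  "extremal_config T u x \<longleftrightarrow>
     (\<exists>P. longest_path T P \<and> length P = 2 * x - 1 \<and>
          u \<notin> set P \<and> u \<rightarrow>\<^bsub>T\<^esub> P ! (x - 1) \<and>
          (\<forall>w\<in>verts T. w \<notin> set P \<longrightarrow> w \<noteq> u \<longrightarrow>
             w \<rightarrow>\<^bsub>T\<^esub> P ! (2 - 1) \<or> w \<rightarrow>\<^bsub>T\<^esub> P ! ((2 * x - 2) - 1)))"

definition bound_k :: "nat \<Rightarrow> nat \<Rightarrow> nat \<Rightarrow> real" where
  "bound_k n k i = 2 * real n + 1 - 2 * real k - real i / real k"

definition bound_Suc_k :: "nat \<Rightarrow> nat \<Rightarrow> nat \<Rightarrow> real" where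
  "bound_Suc_k n k i = 2 * real n + 1 - 2 * real k - (real i + 1) / (real k + 1)"

end

theory Submission
  imports Defs
begin

text \<open>
  Let \<open>P\<close> be a longest path, of length \<open>D\<close>. In a tree every vertex sees \<open>P\<close> from a foot point, so its
  eccentricity is its larger distance to an end of \<open>P\<close>. Hence a leaf has eccentricity
  \<open>e \<ge> D / 2 + 1\<close>, and since eccentricities off \<open>P\<close> are at most \<open>D\<close>, the eccentricities of all vertices
  but the leaf add up to at most \<open>(\<Sum>j\<le>D. max j (D - j)) + (n - D - 2) D\<close>. For \<open>D = 2 y - 2\<close> this
  equals \<open>y (2 n - y - (2 n - 1) / y)\<close>; for \<open>D = 2 y - 3\<close> it is strictly smaller; and \<open>e \<ge> y\<close> in
  both cases. So everything reduces to minimising \<open>y + (2 n - 1) / y\<close> over the positive integers: the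
  minimiser is the unique \<open>x\<close> with \<open>x (x - 1) < 2 n - 1 < x (x + 1)\<close>, no tie being possible as
  \<open>2 n - 1\<close> is odd. For the same reason \<open>i = k\<close> never occurs. In the case of equality a vertex hanging off
  \<open>P\<close> at height at least 2 would have a neighbour off \<open>P\<close> of eccentricity below \<open>D\<close>, so all
  vertices off \<open>P\<close> are adjacent to \<open>P\<close>.
\<close>


section \<open>Integer sequences with unit steps\<close>

text \<open>Without a strict interior peak, a step up can only be followed by steps up, so the
  sequence descends to \<open>m\<close> and rises afterwards. With truncated subtraction,
  \<open>(i - m) + (m - i)\<close> is the absolute difference. The sequence will be the distance to
  a fixed vertex along a path.\<close>

lemma unit_step_valley:
  fixes f :: "nat \<Rightarrow> nat"
  assumes "0 < n"
    and "\<And>i. Suc i < n \<Longrightarrow> f (Suc i) = Suc (f i) \<or> f i = Suc (f (Suc i))"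
    and "\<And>i. Suc (Suc i) < n \<Longrightarrow>
      \<not> (f (Suc i) = Suc (f i) \<and> f (Suc i) = Suc (f (Suc (Suc i))))"
  shows "\<exists>m<n. \<forall>i<n. f i = f m + (i - m) + (m - i)"
  using assms
proof (induction n)
  case 0
  then show ?case by simp
next
  case (Suc n)
  show ?case
  proof (cases "n = 0")
    case True
    then show ?thesis by auto
  next
    case False
    have "\<exists>m<n. \<forall>i<n. f i = f m + (i - m) + (m - i)"
    proof (rule Suc.IH)
      show "0 < n" using False by simp
    next
      fix i assume "Suc i < n"
      then show "f (Suc i) = Suc (f i) \<or> f i = Suc (f (Suc i))"
        by (intro Suc.prems(2)) simp
    next
      fix i assume "Suc (Suc i) < n"
      then show "\<not> (f (Suc i) = Suc (f i) \<and> f (Suc i) = Suc (f (Suc (Suc i))))"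
        by (intro Suc.prems(3)) simp
    qed
    then obtain m where m: "m < n" "\<forall>i<n. f i = f m + (i - m) + (m - i)"
      by blast
    obtain k where k: "n = Suc k" using False by (cases n) auto
    have step: "f n = Suc (f k) \<or> f k = Suc (f n)"
      using Suc.prems(2)[of k] k by simp
    show ?thesis
    proof (cases "f n = Suc (f k)")
      case up: True
      have "f n = f m + (n - m) + (m - n)"
        using m(2)[rule_format, of k] m(1) k up by auto
      then have "\<forall>i<Suc n. f i = f m + (i - m) + (m - i)"
        using m(2) unfolding less_Suc_eq by blast
      then show ?thesis using m(1) less_SucI by blast
    next
      case down: False
      \<comment> \<open>An ascent into \<open>k\<close> followed by this descent would make
        \<open>k\<close> a peak. So the bottom was the last index, and it now moves on to
        \<open>n\<close>.\<close>
      have "m = k"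
      proof (rule ccontr)
        assume "m \<noteq> k"
        then obtain j where j: "k = Suc j" "m \<le> j"
          using m(1) k by (cases k) auto
        have "j < n" "k < n" using j k by auto
        then have "f k = Suc (f j)"
          using m(2)[rule_format, OF \<open>j < n\<close>] m(2)[rule_format, OF \<open>k < n\<close>] j by linarith
        moreover have "f k = Suc (f n)" using step down by blast
        ultimately show False
          using Suc.prems(3)[of j] j k by auto
      qed
      have "f i = f n + (i - n) + (n - i)" if "i < Suc n" for i
      proof (cases "i = n")
        case False
        then have "i < n" using that by simp
        then show ?thesis
          using m(2)[unfolded \<open>m = k\<close>, rule_format, OF \<open>i < n\<close>] step down k by linarith
      qed simp
      then show ?thesis by blast
    qed
  qed
qed

lemma vwalk_nth_adj: "vwalk p H \<Longrightarrow> Suc i < length p \<Longrightarrow> p ! i \<rightarrow>\<^bsub>H\<^esub> p ! Suc i"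
proof (induction arbitrary: i rule: vwalk_induct)
  case (Base u)
  then show ?case by simp
next
  case (Cons u v es)
  then show ?case by (cases i) auto
qed

section \<open>The extremal problem in the diameter\<close>

text \<open>Stripping the two end terms, both equal to the upper limit, leaves the sum for
  \<open>D - 2\<close> with every term raised by one; hence the induction in steps of two.\<close>

lemma sum_max_closed_form:
  fixes D :: nat
  shows "4 * (\<Sum>i\<le>D. max i (D - i)) = 3 * D^2 + 4 * D + D mod 2"
proof (induction D rule: induct_nat_012)
  case (ge2 n)
  have "(\<Sum>i\<le>Suc (Suc n). max i (Suc (Suc n) - i)) =
      2 * Suc (Suc n) + (\<Sum>i\<le>n. max (Suc i) (Suc n - i))"
    by (subst sum.atMost_Suc_shift) (simp add: sum.atMost_Suc)
  also have "(\<Sum>i\<le>n. max (Suc i) (Suc n - i)) = (\<Sum>i\<le>n. Suc (max i (n - i)))"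
    by (intro sum.cong) (auto simp: Suc_diff_le)
  also have "\<dots> = Suc n + (\<Sum>i\<le>n. max i (n - i))"
    by (simp add: sum_Suc)
  finally show ?case
    using ge2 by (simp add: power2_eq_square)
qed simp_all

text \<open>The difference of the two sides is \<open>(y - x) * (x * y - m) / (x * y)\<close>, and
  the window for \<open>m\<close> gives both factors of the numerator the same sign.\<close>

lemma add_divide_minimum:
  fixes m x y :: nat
  assumes "x * (x - 1) < m" "m < x * (x + 1)" "0 < y" "y \<noteq> x"
  shows "real x + real m / real x < real y + real m / real y"
proof -
  have x: "0 < x" using assms(2) by (cases x) auto
  have "0 < (real y - real x) * (real (x * y) - real m)"
  proof (cases "y < x")
    case True
    then have "x * y \<le> x * (x - 1)" by (intro mult_le_mono2) simp
    then have "real (x * y) < real m" using assms(1) by linarith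
    then show ?thesis using True by (simp add: mult_neg_neg)
  next
    case False
    then have "x + 1 \<le> y" using assms(4) by simp
    then have "x * (x + 1) \<le> x * y" by (rule mult_le_mono2)
    then have "real m < real (x * y)" using assms(2) by linarith
    then show ?thesis using False assms(4) by simp
  qed
  then have "0 < (real y - real x) * (real (x * y) - real m) / (real x * real y)"
    using x assms(3) by simp
  also have "\<dots> = (real y + real m / real y) - (real x + real m / real x)"
    using x assms(3) by (simp add: field_simps)
  finally show ?thesis by simp
qed

text \<open>The arithmetic core: \<open>D\<close> stands for the length of a longest path,
  \<open>e\<close> for the eccentricity of the leaf, \<open>M\<close> for the sum of the other
  eccentricities. The estimate is the chain
  \<open>M \<le> N \<le> h * y \<le> B * y \<le> B * e\<close>, and equality needs equality at every
  link.\<close>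

lemma
  fixes n D e x :: nat and M :: int
  defines "N \<equiv> int (\<Sum>i\<le>D. max i (D - i)) + (int n - int D - 2) * int D"
    and "B \<equiv> 2 * real n - real x - (2 * real n - 1) / real x"
  assumes D: "2 \<le> D" "D < n" and e: "D + 2 \<le> 2 * e"
    and x: "x * (x - 1) < 2 * n - 1" "2 * n - 1 < x * (x + 1)" and M: "M \<le> N"
  shows ratio_bound: "real_of_int M \<le> B * real e"
    and ratio_bound_eq_iff: "real_of_int M = B * real e \<longleftrightarrow> D + 2 = 2 * x \<and> e = x \<and> M = N"
proof -
  \<comment> \<open>\<open>y\<close> is \<open>(D + 2) / 2\<close> rounded up, the least value open
    to \<open>e\<close>; \<open>h\<close> is \<open>B\<close> with \<open>y\<close> in place of
    \<open>x\<close>.\<close>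
  define y where "y = (D + 3) div 2"
  define h where "h = 2 * real n - real y - (2 * real n - 1) / real y"
  have y: "0 < y" "y \<le> e" using D(1) e by (auto simp: y_def)
  have S: "4 * int (\<Sum>i\<le>D. max i (D - i)) = 3 * (int D)^2 + 4 * int D + int (D mod 2)"
    using arg_cong[OF sum_max_closed_form[of D], of int] by simp
  \<comment> \<open>By the closed form both sides agree for \<open>D = 2 * c\<close>; for
    \<open>D = 2 * c + 1\<close> the gap is \<open>n - c - 2\<close>, positive by the bounds on
    \<open>D\<close>.\<close>
  have Nh_int: "N \<le> 2 * int n * int y - (int y)^2 - (2 * int n - 1) \<and>
      (N = 2 * int n * int y - (int y)^2 - (2 * int n - 1) \<longleftrightarrow> even D)"
  proof (cases "even D")
    case True
    then obtain c where c: "D = 2 * c" by blast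
    then have "y = c + 1" by (simp add: y_def)
    then show ?thesis
      using S True unfolding N_def c by (simp add: algebra_simps power2_eq_square)
  next
    case False
    then obtain c where c: "D = 2 * c + 1" by (rule oddE)
    then have yc: "y = c + 2" by (simp add: y_def)
    have "D mod 2 = 1" using c by simp
    then have "2 * int n * int y - (int y)^2 - (2 * int n - 1) - N = int n - int c - 2"
      using S unfolding N_def yc by (simp add: c algebra_simps power2_eq_square)
    moreover have "0 < int n - int c - 2" using D c by linarith
    ultimately show ?thesis using False by linarith
  qed
  have hy: "h * real y = real_of_int (2 * int n * int y - (int y)^2 - (2 * int n - 1))"
    using y(1) by (simp add: h_def field_simps power2_eq_square)
  have Nh: "real_of_int N \<le> h * real y" and Nh_eq: "real_of_int N = h * real y \<longleftrightarrow> even D"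
    using Nh_int unfolding hy of_int_le_iff of_int_eq_iff by blast+
  \<comment> \<open>Positivity of \<open>N\<close> passes to \<open>h\<close> and then to
    \<open>B\<close>, as the last link of the chain requires.\<close>
  have "4 * N = 3 * (int D)^2 + int (D mod 2) + 4 * ((int n - int D - 1) * int D)"
    using S unfolding N_def by (simp add: algebra_simps)
  moreover have "0 \<le> (int n - int D - 1) * int D" using D by simp
  moreover have "0 < (int D)^2" using D by simp
  ultimately have "0 < N" by linarith
  then have "0 < h * real y" using Nh by linarith
  then have h: "0 < h" using y(1) by (simp add: zero_less_mult_iff)
  have nat_m: "real (2 * n - 1) = 2 * real n - 1" using D by simp
  have hB: "h < B" if "y \<noteq> x"
    using add_divide_minimum[OF x y(1) that] unfolding h_def B_def nat_m by linarith
  have hB_eq: "h = B" if "y = x" using that by (simp add: h_def B_def)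
  have "h \<le> B" using hB hB_eq by (cases "y = x") auto
  then have B: "0 < B" using h by linarith
  have chain: "real_of_int M \<le> real_of_int N" "h * real y \<le> B * real y" "B * real y \<le> B * real e"
    using M \<open>h \<le> B\<close> B y by simp_all
  then show "real_of_int M \<le> B * real e" using Nh by linarith
  show "real_of_int M = B * real e \<longleftrightarrow> D + 2 = 2 * x \<and> e = x \<and> M = N"
  proof
    assume "real_of_int M = B * real e"
    then have eq: "real_of_int M = real_of_int N" "real_of_int N = h * real y"
        "h * real y = B * real y" "B * real y = B * real e"
      using chain Nh by linarith+
    have "even D" using eq(2) Nh_eq by blast
    moreover have "y = x" using eq(3) hB y(1) by force
    moreover have "e = y" using eq(4) B by simp
    ultimately show "D + 2 = 2 * x \<and> e = x \<and> M = N"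
      using eq(1) unfolding y_def by auto
  next
    assume R: "D + 2 = 2 * x \<and> e = x \<and> M = N"
    then have "D = 2 * (x - 1)" "y = x" by (auto simp: y_def)
    then show "real_of_int M = B * real e"
      using R Nh_eq hB_eq by simp
  qed
qed


section \<open>Distances in a connected symmetric digraph\<close>

locale undirected_tree_graph = graph +
  assumes connected: "connected G"
    and cycle_short: "cycle p \<Longrightarrow> length p < 3"
begin

text \<open>A natural-number distance keeps the arithmetic away from extended reals;
  \<open>gdist_eq_hop\<close> identifies it with \<open>gdist\<close>.\<close>

definition hop :: "'a \<Rightarrow> 'a \<Rightarrow> nat" where
  "hop v w = (LEAST l. \<exists>p. awalk v p w \<and> length p = l)"

lemma adj_sym: "v \<rightarrow>\<^bsub>G\<^esub> w \<Longrightarrow> w \<rightarrow>\<^bsub>G\<^esub> v"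
  using arcs_ends_symmetric[OF sym_arcs] .

lemma reachable_verts: "v \<in> verts G \<Longrightarrow> w \<in> verts G \<Longrightarrow> v \<rightarrow>\<^sup>* w"
  using symmetric_connected_imp_strongly_connected[OF sym_arcs connected]
  by (auto simp: strongly_connected_def)

lemma verts_nonempty: "verts G \<noteq> {}"
  using symmetric_connected_imp_strongly_connected[OF sym_arcs connected]
  by (auto simp: strongly_connected_def)

lemma hop_le: "awalk v p w \<Longrightarrow> hop v w \<le> length p"
  unfolding hop_def by (rule Least_le) blast

lemma hop_awalk:
  assumes "v \<in> verts G" "w \<in> verts G"
  obtains p where "awalk v p w" "length p = hop v w"
proof -
  obtain q where "awalk v q w"
    using reachable_verts[OF assms] by (auto simp: reachable_awalk)
  then have "\<exists>l p. awalk v p w \<and> length p = l" by blast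
  from LeastI_ex[OF this] show ?thesis
    using that unfolding hop_def by blast
qed

lemma awalk_cost_one: "awalk_cost (\<lambda>_. 1) p = real (length p)"
  by (induction p) simp_all

text \<open>With unit costs a cheapest walk is a shortest one, and a cheapest walk can be chosen as
  a simple path; this path realises both distances.\<close>

lemma hop_apath:
  assumes "v \<in> verts G" "w \<in> verts G"
  obtains p where "apath v p w" "length p = hop v w" "\<mu> (\<lambda>_. 1) v w = ereal (hop v w)"
proof -
  obtain p where p: "apath v p w" and mu: "\<mu> (\<lambda>_. 1) v w = awalk_cost (\<lambda>_. 1) p"
    using min_cost_awalk[OF reachable_verts[OF assms], of "\<lambda>_. 1"] by auto
  obtain q where q: "awalk v q w" "length q = hop v w"
    using hop_awalk[OF assms] .
  have "\<mu> (\<lambda>_. 1) v w \<le> awalk_cost (\<lambda>_. 1) q"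
    by (rule min_cost_le_walk_cost[OF q(1)])
  then have "length p \<le> length q"
    using mu by (simp add: awalk_cost_one)
  moreover have "hop v w \<le> length p"
    using p by (intro hop_le) (simp add: apath_def)
  ultimately have "length p = hop v w"
    using q(2) by simp
  then show ?thesis
    using that[OF p] mu by (simp add: awalk_cost_one)
qed

lemma gdist_eq_hop:
  assumes "v \<in> verts G" "w \<in> verts G"
  shows "gdist G v w = real (hop v w)"
  by (rule hop_apath[OF assms]) (simp add: gdist_def)

lemma hop_refl: "v \<in> verts G \<Longrightarrow> hop v v = 0"
  using hop_le[of v "[]" v] by (simp add: awalk_Nil_iff)

lemma hop_eq_0D:
  assumes "v \<in> verts G" "w \<in> verts G" "hop v w = 0"
  shows "v = w"
proof -
  obtain p where "awalk v p w" "length p = hop v w"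
    using hop_awalk[OF assms(1,2)] .
  then show ?thesis using assms(3) by (simp add: awalk_Nil_iff)
qed

lemma hop_triangle:
  assumes "u \<in> verts G" "v \<in> verts G" "w \<in> verts G"
  shows "hop u w \<le> hop u v + hop v w"
proof -
  obtain p where p: "awalk u p v" "length p = hop u v"
    using hop_awalk[OF assms(1,2)] .
  obtain q where q: "awalk v q w" "length q = hop v w"
    using hop_awalk[OF assms(2,3)] .
  show ?thesis
    using hop_le[OF awalk_appendI[OF p(1) q(1)]] p(2) q(2) by simp
qed

lemma hop_adj_le:
  assumes "v \<rightarrow>\<^bsub>G\<^esub> w"
  shows "hop v w \<le> 1"
proof -
  obtain e where "e \<in> arcs G" "tail G e = v" "head G e = w"
    using assms by (rule reachableE)
  then have "awalk v [e] w" using arc_implies_awalk[of e] by simp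
  then show ?thesis using hop_le[of v "[e]" w] by simp
qed

text \<open>An edge is a pair of opposite arcs, so the arc list cannot simply be reversed: each arc
  is replaced by an opposite one.\<close>

lemma awalk_rev:
  assumes "awalk v p w"
  shows "\<exists>q. awalk w q v \<and> length q = length p"
  using assms
proof (induction p arbitrary: v)
  case Nil
  then show ?case by (auto simp: awalk_Nil_iff)
next
  case (Cons e p)
  then obtain q where q: "awalk w q (head G e)" "length q = length p"
    by (auto simp: awalk_Cons_iff)
  have "tail G e \<rightarrow>\<^bsub>G\<^esub> head G e"
    using Cons.prems by (auto simp: awalk_Cons_iff in_arcs_imp_in_arcs_ends)
  then obtain e' where "e' \<in> arcs G" "tail G e' = head G e" "head G e' = tail G e"
    by (meson adj_sym reachableE)
  then have "awalk (head G e) [e'] v"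
    using Cons.prems arc_implies_awalk[of e'] by (auto simp: awalk_Cons_iff)
  with q have "awalk w (q @ [e']) v \<and> length (q @ [e']) = length (e # p)"
    by (auto intro: awalk_appendI)
  then show ?case by blast
qed

lemma hop_sym:
  assumes "v \<in> verts G" "w \<in> verts G"
  shows "hop v w = hop w v"
proof -
  have "hop v w \<le> hop w v" if vw: "v \<in> verts G" "w \<in> verts G" for v w
  proof -
    obtain p where p: "awalk w p v" "length p = hop w v"
      using hop_awalk[OF vw(2,1)] .
    obtain q where "awalk v q w" "length q = length p"
      using awalk_rev[OF p(1)] by blast
    then show ?thesis using hop_le p(2) by metis
  qed
  then show ?thesis using assms by (simp add: antisym)
qed

text \<open>\<open>c\<close> is the second vertex of a shortest walk; by the triangle inequality the
  rest of that walk is shortest too.\<close>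

lemma hop_step:
  assumes "v \<in> verts G" "r \<in> verts G" "v \<noteq> r"
  obtains c where "v \<rightarrow>\<^bsub>G\<^esub> c" "hop v r = Suc (hop c r)"
proof -
  obtain p where p: "awalk v p r" "length p = hop v r"
    using hop_awalk[OF assms(1,2)] .
  then obtain e q where eq: "p = e # q"
    using assms(3) by (cases p) (auto simp: awalk_Nil_iff)
  then have e: "v \<rightarrow>\<^bsub>G\<^esub> head G e" and q: "awalk (head G e) q r"
    using p by (auto simp: awalk_Cons_iff in_arcs_imp_in_arcs_ends)
  have "hop v r \<le> Suc (hop (head G e) r)"
    using hop_triangle[of v "head G e" r] hop_adj_le[OF e] adj_in_verts[OF e] assms by simp
  then show ?thesis
    using that[OF e] hop_le[OF q] p(2) eq by simp
qed

lemma hop_eq_1D: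
  assumes "v \<in> verts G" "w \<in> verts G" "hop v w = 1"
  shows "v \<rightarrow>\<^bsub>G\<^esub> w"
proof -
  have "v \<noteq> w" using hop_refl[OF assms(1)] assms(3) by auto
  then obtain c where c: "v \<rightarrow>\<^bsub>G\<^esub> c" "hop v w = Suc (hop c w)"
    using hop_step[OF assms(1,2)] by blast
  then have "c = w"
    using hop_eq_0D[OF adj_in_verts(2)[OF c(1)] assms(2)] assms(3) by simp
  then show ?thesis using c by simp
qed


section \<open>Consequences of acyclicity\<close>

text \<open>Descending from two vertices of a level simultaneously until the descents meet joins them by a path
  that stays on or below that level; a further arc or vertex then closes a cycle.\<close>

lemma level_path:
  assumes "v \<in> verts G" "w \<in> verts G" "r \<in> verts G" "hop v r = h" "hop w r = h"
  shows "\<exists>p. apath v p w \<and> (\<forall>x\<in>set (awalk_verts v p). hop x r \<le> h) \<and> (v \<noteq> w \<longrightarrow> 2 \<le> length p)"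
  using assms
proof (induction h arbitrary: v w)
  case 0
  have vw: "v = w" using hop_eq_0D[OF 0(1,3,4)] hop_eq_0D[OF 0(2,3,5)] by (rule trans[OF _ sym])
  then show ?case
    using 0 by (intro exI[of _ "[]"]) (simp add: apath_Nil_iff)
next
  case (Suc h)
  show ?case
  proof (cases "v = w")
    case True
    then show ?thesis
      using Suc.prems by (intro exI[of _ "[]"]) (simp add: apath_Nil_iff)
  next
    case False
    have "v \<noteq> r" "w \<noteq> r" using hop_refl[OF Suc.prems(3)] Suc.prems(4,5) by auto
    obtain v' where v': "v \<rightarrow>\<^bsub>G\<^esub> v'" "hop v' r = h"
      using hop_step[OF Suc.prems(1,3) \<open>v \<noteq> r\<close>] Suc.prems(4) by auto
    obtain w' where w': "w \<rightarrow>\<^bsub>G\<^esub> w'" "hop w' r = h"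
      using hop_step[OF Suc.prems(2,3) \<open>w \<noteq> r\<close>] Suc.prems(5) by auto
    obtain p where p: "apath v' p w'" "\<forall>x\<in>set (awalk_verts v' p). hop x r \<le> h"
      using Suc.IH[OF adj_in_verts(2)[OF v'(1)] adj_in_verts(2)[OF w'(1)] Suc.prems(3) v'(2) w'(2)]
      by blast
    obtain e where e: "e \<in> arcs G" "tail G e = v" "head G e = v'"
      using v'(1) by blast
    obtain f where f: "f \<in> arcs G" "tail G f = w'" "head G f = w"
      using adj_sym[OF w'(1)] by blast
    have walk: "awalk v' (p @ [f]) w"
      using p f arc_implies_awalk[of f] by (auto simp: apath_def intro: awalk_appendI)
    have verts: "awalk_verts v' (p @ [f]) = awalk_verts v' p @ [w]"
      using awalk_verts_append[OF walk] f by simp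
    \<comment> \<open>Both \<open>v\<close> and \<open>w\<close> lie one level above everything on
      the inner path, so the extended path stays simple.\<close>
    have out: "v \<notin> set (awalk_verts v' p)" "w \<notin> set (awalk_verts v' p)"
      using p(2) Suc.prems by auto
    have "apath v (e # p @ [f]) w"
      using walk verts e p out False by (auto simp: apath_def awalk_Cons_iff)
    moreover have "\<forall>x\<in>set (awalk_verts v (e # p @ [f])). hop x r \<le> Suc h"
      using p(2) verts e Suc.prems by auto
    ultimately show ?thesis by (intro exI[of _ "e # p @ [f]"]) simp
  qed
qed

text \<open>Adjacent vertices on one level would close the path of \<open>level_path\<close> to a
  cycle of length at least 3.\<close>

lemma hop_adj_neq:
  assumes "v \<rightarrow>\<^bsub>G\<^esub> w" "r \<in> verts G"
  shows "hop v r \<noteq> hop w r"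
proof
  assume eq: "hop v r = hop w r"
  have "v \<noteq> w" using assms(1) adj_not_same[of v] by auto
  then obtain p where p: "apath v p w" "2 \<le> length p"
    using level_path[OF adj_in_verts[OF assms(1)] assms(2) eq refl] by blast
  obtain e where e: "e \<in> arcs G" "tail G e = w" "head G e = v"
    using adj_sym[OF assms(1)] by blast
  have "cycle (e # p)"
    using p e unfolding cycle_def apath_def by (intro exI[of _ w]) (auto simp: awalk_Cons_iff)
  then show False using cycle_short p(2) by force
qed

lemma hop_adj:
  assumes "v \<rightarrow>\<^bsub>G\<^esub> w" "r \<in> verts G"
  shows "hop v r = Suc (hop w r) \<or> hop w r = Suc (hop v r)"
proof -
  have "v \<in> verts G" "w \<in> verts G" using adj_in_verts[OF assms(1)] by auto
  then have "hop v r \<le> Suc (hop w r)" "hop w r \<le> Suc (hop v r)"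
    using hop_triangle[of v w r] hop_triangle[of w v r] assms hop_adj_le[of v w]
      hop_adj_le[of w v] adj_sym[of v w] by auto
  then show ?thesis using hop_adj_neq[OF assms] by linarith
qed

text \<open>Two distinct neighbours one level below \<open>v\<close> are joined by a path avoiding
  \<open>v\<close>, which closes to a cycle through \<open>v\<close>. In the tree rooted at
  \<open>r\<close> this is uniqueness of the parent.\<close>

lemma parent_unique:
  assumes "v \<rightarrow>\<^bsub>G\<^esub> c" "v \<rightarrow>\<^bsub>G\<^esub> d" "r \<in> verts G" "hop v r = Suc (hop c r)" "hop v r = Suc (hop d r)"
  shows "c = d"
proof (rule ccontr)
  assume "c \<noteq> d"
  then obtain p where p: "apath c p d" "2 \<le> length p"
      "\<forall>x\<in>set (awalk_verts c p). hop x r \<le> hop c r"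
    using level_path[OF adj_in_verts(2)[OF assms(1)] adj_in_verts(2)[OF assms(2)] assms(3) refl] assms(4,5)
    by auto
  obtain e where e: "e \<in> arcs G" "tail G e = v" "head G e = c"
    using assms(1) by blast
  obtain f where f: "f \<in> arcs G" "tail G f = d" "head G f = v"
    using adj_sym[OF assms(2)] by blast
  have walk: "awalk c (p @ [f]) v"
    using p f arc_implies_awalk[of f] by (auto simp: apath_def intro: awalk_appendI)
  have verts: "awalk_verts c (p @ [f]) = awalk_verts c p @ [v]"
    using awalk_verts_append[OF walk] f by simp
  have "v \<notin> set (awalk_verts c p)"
    using p(3) assms(4) by auto
  then have "distinct (awalk_verts c (p @ [f]))"
    using verts p(1) by (simp add: apath_def)
  then have "cycle (e # p @ [f])"
    using walk e unfolding cycle_def by (intro exI[of _ v]) (auto simp: awalk_Cons_iff)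
  then show False using cycle_short p(2) by force
qed


section \<open>Projection of a vertex onto a path\<close>

text \<open>Along \<open>P\<close> the distance to \<open>v\<close> changes by one at each step
  (\<open>hop_adj\<close>). At an interior peak \<open>parent_unique\<close> would identify the two
  path neighbours, against distinctness. So the distances form a valley, and its bottom
  \<open>m\<close> is the foot point of \<open>v\<close>.\<close>

lemma path_projection:
  assumes "vpath P G" "v \<in> verts G"
  shows "\<exists>m<length P. \<forall>i<length P. hop v (P ! i) = hop v (P ! m) + (i - m) + (m - i)"
proof -
  have in_verts: "P ! i \<in> verts G" if "i < length P" for i
    using assms(1) that by (auto simp: vpath_def vwalk_def)
  have adj: "P ! i \<rightarrow>\<^bsub>G\<^esub> P ! Suc i" if "Suc i < length P" for i
    using assms(1) that by (intro vwalk_nth_adj) (auto simp: vpath_def)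
  have "\<exists>m<length P. \<forall>i<length P. hop (P ! i) v = hop (P ! m) v + (i - m) + (m - i)"
  proof (rule unit_step_valley)
    show "0 < length P" using assms(1) by (auto simp: vpath_def vwalk_def)
    show "hop (P ! Suc i) v = Suc (hop (P ! i) v) \<or> hop (P ! i) v = Suc (hop (P ! Suc i) v)"
      if "Suc i < length P" for i
      using hop_adj[OF adj[OF that] assms(2)] by blast
    show "\<not> (hop (P ! Suc i) v = Suc (hop (P ! i) v) \<and>
        hop (P ! Suc i) v = Suc (hop (P ! Suc (Suc i)) v))"
      if i: "Suc (Suc i) < length P" for i
    proof
      assume "hop (P ! Suc i) v = Suc (hop (P ! i) v) \<and>
        hop (P ! Suc i) v = Suc (hop (P ! Suc (Suc i)) v)"
      then have "P ! i = P ! Suc (Suc i)"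
        using parent_unique[OF adj_sym[OF adj] adj assms(2)] i by auto
      moreover have "distinct P" using assms(1) by (auto simp: vpath_def)
      ultimately show False using i by (simp add: nth_eq_iff_index_eq)
    qed
  qed
  then show ?thesis
    by (metis hop_sym[OF assms(2) in_verts])
qed

text \<open>A vertex of the path is its own projection, being at distance 0 from itself.\<close>

lemma path_hop:
  assumes "vpath P G" "i < length P" "j < length P"
  shows "hop (P ! i) (P ! j) = (j - i) + (i - j)"
proof -
  have v: "P ! i \<in> verts G"
    using assms by (auto simp: vpath_def vwalk_def)
  obtain m where m: "\<forall>l<length P. hop (P ! i) (P ! l) = hop (P ! i) (P ! m) + (l - m) + (m - l)"
    using path_projection[OF assms(1) v] by blast
  have "hop (P ! i) (P ! i) = 0" by (rule hop_refl[OF v])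
  then have "hop (P ! i) (P ! m) = 0" "m = i"
    using m[rule_format, OF assms(2)] by linarith+
  then show ?thesis using m[rule_format, OF assms(3)] by linarith
qed

lemma hop_vpath:
  assumes "v \<in> verts G" "w \<in> verts G"
  shows "\<exists>Q. vpath Q G \<and> length Q = Suc (hop v w)"
proof (rule hop_apath[OF assms])
  fix p assume p: "apath v p w" and len: "length p = hop v w"
  have "vwalk (awalk_verts v p) G"
    using p by (intro awalk_imp_vwalk[of v p w]) (simp add: apath_def)
  then have "vpath (awalk_verts v p) G \<and> length (awalk_verts v p) = Suc (hop v w)"
    using p len by (auto simp: apath_def length_awalk_verts)
  then show ?thesis by blast
qed

lemma ex_longest_path: "\<exists>P. longest_path G P"
proof -
  obtain v where v: "v \<in> verts G" using verts_nonempty by blast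
  have "length Q < Suc (card (verts G))" if "vpath Q G" for Q
  proof -
    have "card (set Q) \<le> card (verts G)"
      using that by (intro card_mono) (auto simp: vpath_def vwalk_def)
    then show ?thesis using that by (simp add: vpath_def distinct_card)
  qed
  then show ?thesis
    using ex_has_greatest_nat[of "\<lambda>Q. vpath Q G" "[v]" length "Suc (card (verts G))"] v
    unfolding longest_path_def by (auto intro: vpath_self)
qed

lemma leaf_neighbour_unique:
  assumes "leaf G u" "u \<rightarrow>\<^bsub>G\<^esub> c" "u \<rightarrow>\<^bsub>G\<^esub> d"
  shows "c = d"
proof -
  obtain a where a: "out_arcs G u = {a}"
    using assms(1) by (auto simp: leaf_def out_degree_def card_1_singleton_iff)
  have "head G a = z" if "u \<rightarrow>\<^bsub>G\<^esub> z" for z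
  proof -
    obtain e where "e \<in> arcs G" "tail G e = u" "head G e = z"
      using \<open>u \<rightarrow>\<^bsub>G\<^esub> z\<close> by (rule reachableE)
    then show ?thesis using a by (auto simp: out_arcs_def)
  qed
  then show ?thesis using assms(2,3) by metis
qed

end


section \<open>Eccentricities along a longest path\<close>

locale diametral_path = undirected_tree_graph +
  fixes P
  assumes longest: "longest_path G P"
begin

text \<open>The name is justified by \<open>hop_le_diam\<close>.\<close>

definition diam :: nat where
  "diam = length P - 1"

text \<open>The eccentricity as a natural number, by \<open>ecc_eq_far\<close>.\<close>

definition far :: "'a \<Rightarrow> nat" where
  "far v = max (hop v (P ! 0)) (hop v (P ! diam))"

lemma vpath_P: "vpath P G"
  using longest by (simp add: longest_path_def)

lemma length_P: "length P = Suc diam"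
  using vpath_P by (auto simp: diam_def vpath_def vwalk_def)

lemma distinct_P: "distinct P"
  using vpath_P by (simp add: vpath_def)

lemma set_P_subset: "set P \<subseteq> verts G"
  using vpath_P by (auto simp: vpath_def vwalk_def)

lemma nth_P_in_verts: "i \<le> diam \<Longrightarrow> P ! i \<in> verts G"
  using set_P_subset length_P by (auto simp: less_Suc_eq_le)

lemma nth_P_adj: "i < diam \<Longrightarrow> P ! i \<rightarrow>\<^bsub>G\<^esub> P ! Suc i"
  using vpath_P length_P by (intro vwalk_nth_adj) (auto simp: vpath_def)

text \<open>A shortest walk visits distinct vertices, so it is a path and no longer than
  \<open>P\<close>.\<close>

lemma hop_le_diam:
  assumes "v \<in> verts G" "w \<in> verts G"
  shows "hop v w \<le> diam"
proof -
  obtain Q where Q: "vpath Q G" "length Q = Suc (hop v w)"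
    using hop_vpath[OF assms] by blast
  then have "length Q \<le> length P"
    using longest unfolding longest_path_def by blast
  then show ?thesis using Q(2) length_P by simp
qed

definition foot :: "'a \<Rightarrow> nat" where
  "foot v = (SOME m. m \<le> diam \<and>
     (\<forall>i\<le>diam. hop v (P ! i) = hop v (P ! m) + (i - m) + (m - i)))"

definition height :: "'a \<Rightarrow> nat" where
  "height v = hop v (P ! foot v)"

lemma
  assumes "v \<in> verts G"
  shows foot_le: "foot v \<le> diam"
    and hop_nth: "i \<le> diam \<Longrightarrow> hop v (P ! i) = height v + (i - foot v) + (foot v - i)"
proof -
  have "\<exists>m. m \<le> diam \<and> (\<forall>i\<le>diam. hop v (P ! i) = hop v (P ! m) + (i - m) + (m - i))"
    using path_projection[OF vpath_P assms] unfolding length_P less_Suc_eq_le .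
  then have "foot v \<le> diam \<and>
      (\<forall>i\<le>diam. hop v (P ! i) = hop v (P ! foot v) + (i - foot v) + (foot v - i))"
    unfolding foot_def by (rule someI_ex)
  then show "foot v \<le> diam"
    and "i \<le> diam \<Longrightarrow> hop v (P ! i) = height v + (i - foot v) + (foot v - i)"
    unfolding height_def by blast+
qed

lemma far_eq:
  assumes "v \<in> verts G"
  shows "far v = height v + max (foot v) (diam - foot v)"
  unfolding far_def hop_nth[OF assms le0] hop_nth[OF assms order_refl]
  using foot_le[OF assms] by simp

lemma far_le_diam: "v \<in> verts G \<Longrightarrow> far v \<le> diam"
  by (simp add: far_def hop_le_diam nth_P_in_verts)

lemma height_pos:
  assumes "v \<in> verts G" "v \<notin> set P"
  shows "0 < height v"
proof (rule ccontr)
  assume "\<not> ?thesis"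
  then have "v = P ! foot v"
    using hop_eq_0D[OF assms(1) nth_P_in_verts[OF foot_le[OF assms(1)]]] by (simp add: height_def)
  then show False
    using assms(2) foot_le[OF assms(1)] length_P nth_mem[of "foot v" P] by simp
qed

text \<open>The detour through the foot of \<open>w\<close> ends with \<open>height w\<close> steps.
  Since \<open>far w \<le> diam\<close>, these are no more than the steps from that foot to either
  end of \<open>P\<close>, so the end lying in the direction of travel is at least as far from
  \<open>v\<close> as \<open>w\<close> is.\<close>

lemma hop_le_far:
  assumes "v \<in> verts G" "w \<in> verts G"
  shows "hop v w \<le> far v"
proof -
  note fw = foot_le[OF assms(2)] and fv = foot_le[OF assms(1)]
  have "hop v w \<le> hop v (P ! foot w) + hop (P ! foot w) w"
    by (intro hop_triangle assms nth_P_in_verts fw)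
  also have "hop (P ! foot w) w = height w"
    using hop_sym[OF assms(2) nth_P_in_verts[OF fw]] by (simp add: height_def)
  also have "hop v (P ! foot w) = height v + (foot w - foot v) + (foot v - foot w)"
    by (rule hop_nth[OF assms(1) fw])
  finally show ?thesis
    using far_le_diam[OF assms(2)] fw fv
    unfolding far_eq[OF assms(1)] far_eq[OF assms(2)] by linarith
qed

lemma ecc_eq_far:
  assumes "v \<in> verts G"
  shows "ecc G v = real (far v)"
  unfolding ecc_def
proof (rule Max_eqI)
  show "finite (gdist G v ` verts G)" by simp
  show "y \<le> real (far v)" if "y \<in> gdist G v ` verts G" for y
    using that assms by (auto simp: gdist_eq_hop hop_le_far)
  have "real (far v) = gdist G v (P ! 0) \<or> real (far v) = gdist G v (P ! diam)"
    using assms by (auto simp: far_def max_def gdist_eq_hop nth_P_in_verts)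
  then show "real (far v) \<in> gdist G v ` verts G"
    using nth_P_in_verts[of 0] nth_P_in_verts[of diam] by auto
qed

lemma far_nth: "i \<le> diam \<Longrightarrow> far (P ! i) = max i (diam - i)"
  using path_hop[OF vpath_P] length_P by (simp add: far_def)

lemma sum_far_path: "(\<Sum>v\<in>set P. far v) = (\<Sum>i\<le>diam. max i (diam - i))"
proof -
  have "set P = (!) P ` {..diam}"
    using length_P by (auto simp: set_conv_nth less_Suc_eq_le)
  moreover have "inj_on ((!) P) {..diam}"
    using distinct_P length_P by (auto intro!: inj_on_nth)
  ultimately show ?thesis
    by (simp add: sum.reindex far_nth)
qed

text \<open>An interior vertex of \<open>P\<close> has two distinct neighbours, so a leaf on
  \<open>P\<close> is one of its ends.\<close>

lemma far_end_of_leaf: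
  assumes "leaf G u" "u \<in> set P"
  shows "far u = diam"
proof -
  obtain i where i: "i \<le> diam" "u = P ! i"
    using assms(2) length_P by (metis in_set_conv_nth less_Suc_eq_le)
  have "\<not> (0 < i \<and> i < diam)"
  proof
    assume "0 < i \<and> i < diam"
    then obtain j where j: "i = Suc j" "Suc j < diam" by (cases i) auto
    then have "u \<rightarrow>\<^bsub>G\<^esub> P ! j" "u \<rightarrow>\<^bsub>G\<^esub> P ! Suc (Suc j)"
      using adj_sym[OF nth_P_adj[of j]] nth_P_adj[of "Suc j"] i by auto
    then have "P ! j = P ! Suc (Suc j)"
      using leaf_neighbour_unique[OF assms(1)] by blast
    then show False
      using distinct_P length_P j by (simp add: nth_eq_iff_index_eq)
  qed
  then show ?thesis
    using far_nth[OF i(1)] i by auto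
qed

text \<open>Off \<open>P\<close> the leaf has positive height, and the farther end is at least
  \<open>diam / 2\<close> from its foot.\<close>

lemma far_leaf_ge:
  assumes "leaf G u" "2 \<le> diam"
  shows "diam + 2 \<le> 2 * far u"
proof (cases "u \<in> set P")
  case True
  then show ?thesis using far_end_of_leaf assms by simp
next
  case False
  have u: "u \<in> verts G" using assms(1) by (simp add: leaf_def)
  show ?thesis
    using far_eq[OF u] foot_le[OF u] height_pos[OF u False] by simp
qed

lemma card_set_P: "card (set P) = Suc diam"
  using distinct_P length_P by (simp add: distinct_card)

lemma diam_less_card: "diam < card (verts G)"
  using card_mono[OF finite_verts set_P_subset] card_set_P by simp

text \<open>If \<open>diam\<close> is at most 1, every foot is an end of \<open>P\<close>, so a
  vertex off \<open>P\<close> would have \<open>far\<close> above \<open>diam\<close>; then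
  \<open>P\<close> covers all vertices, at most two.\<close>

lemma diam_ge_2:
  assumes "3 \<le> card (verts G)"
  shows "2 \<le> diam"
proof (rule ccontr)
  assume small: "\<not> 2 \<le> diam"
  have "verts G \<subseteq> set P"
  proof
    fix v assume v: "v \<in> verts G"
    show "v \<in> set P"
      using far_eq[OF v] foot_le[OF v] height_pos[OF v] far_le_diam[OF v] small
      by (cases "v \<in> set P") auto
  qed
  then show False
    using card_mono[of "set P" "verts G"] card_set_P small assms by simp
qed

lemma hop_foot_eq_1:
  assumes "v \<in> verts G" "v \<notin> set P" "i \<le> diam" "v \<rightarrow>\<^bsub>G\<^esub> P ! i"
  shows "height v = 1" "foot v = i"
proof -
  have "height v + (i - foot v) + (foot v - i) \<le> 1"
    using hop_adj_le[OF assms(4)] hop_nth[OF assms(1,3)] by simp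
  then show "height v = 1" "foot v = i"
    using height_pos[OF assms(1,2)] by linarith+
qed

lemma adj_foot:
  assumes "v \<in> verts G" "height v = 1"
  shows "v \<rightarrow>\<^bsub>G\<^esub> P ! foot v"
  using hop_eq_1D[OF assms(1) nth_P_in_verts[OF foot_le[OF assms(1)]]] assms(2)
  by (simp add: height_def)

text \<open>\<open>Suc c\<close> is the least value of \<open>far\<close> off \<open>P\<close>; it
  forces height 1 and a foot exactly in the middle.\<close>

lemma far_half_iff:
  assumes "v \<in> verts G" "v \<notin> set P" "diam = 2 * c"
  shows "far v = Suc c \<longleftrightarrow> v \<rightarrow>\<^bsub>G\<^esub> P ! c"
proof
  assume "far v = Suc c"
  then have "height v = 1" "foot v = c"
    using far_eq[OF assms(1)] height_pos[OF assms(1,2)] foot_le[OF assms(1)] assms(3) by auto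
  then show "v \<rightarrow>\<^bsub>G\<^esub> P ! c"
    using adj_foot[OF assms(1)] by simp
next
  assume "v \<rightarrow>\<^bsub>G\<^esub> P ! c"
  then show "far v = Suc c"
    using hop_foot_eq_1[OF assms(1,2), of c] far_eq[OF assms(1)] assms(3) by simp
qed

section \<open>Vertices off the path in the case of equality\<close>

lemma off_path_far_diam_iff:
  assumes leaf: "leaf G u" and u: "u \<notin> set P" "u \<rightarrow>\<^bsub>G\<^esub> P ! c" "c \<le> diam"
    and diam: "1 \<le> diam"
  shows "(\<forall>w\<in>verts G - insert u (set P). far w = diam) \<longleftrightarrow>
    (\<forall>w\<in>verts G - insert u (set P). w \<rightarrow>\<^bsub>G\<^esub> P ! 1 \<or> w \<rightarrow>\<^bsub>G\<^esub> P ! (diam - 1))"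
proof
  assume all: "\<forall>w\<in>verts G - insert u (set P). far w = diam"
  show "\<forall>w\<in>verts G - insert u (set P). w \<rightarrow>\<^bsub>G\<^esub> P ! 1 \<or> w \<rightarrow>\<^bsub>G\<^esub> P ! (diam - 1)"
  proof
    fix w assume w: "w \<in> verts G - insert u (set P)"
    then have wV: "w \<in> verts G" "w \<notin> set P" by auto
    have foot: "foot w \<le> diam" by (rule foot_le[OF wV(1)])
    have foot_in: "P ! foot w \<in> verts G" by (rule nth_P_in_verts[OF foot])
    have "height w = 1"
    proof (rule ccontr)
      assume "height w \<noteq> 1"
      then have ge2: "2 \<le> height w" using height_pos[OF wV] by simp
      have "P ! foot w \<in> set P" using foot length_P by simp
      then have "w \<noteq> P ! foot w" using wV(2) by metis
      \<comment> \<open>\<open>z\<close> is the next vertex on a shortest walk from \<open>w\<close>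
        to its foot. It is again off \<open>P\<close> and not the leaf, yet its distances to both
        ends stay below \<open>far w\<close>, against \<open>far z = diam\<close>.\<close>
      then obtain z where z: "w \<rightarrow>\<^bsub>G\<^esub> z" "hop w (P ! foot w) = Suc (hop z (P ! foot w))"
        using hop_step[OF wV(1) foot_in] by blast
      have zV: "z \<in> verts G" by (rule adj_in_verts(2)[OF z(1)])
      have hz: "Suc (hop z (P ! foot w)) = height w"
        using z(2) by (simp add: height_def)
      have "z \<notin> set P"
      proof
        assume "z \<in> set P"
        then obtain j where "j \<le> diam" "z = P ! j"
          using length_P by (metis in_set_conv_nth less_Suc_eq_le)
        then have "height w = 1"
          using hop_foot_eq_1[OF wV] z(1) by simp
        then show False using ge2 by simp
      qed
      \<comment> \<open>The only neighbour of the leaf lies on \<open>P\<close>, whereas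
        \<open>w\<close> does not.\<close>
      moreover have "z \<noteq> u"
      proof
        assume "z = u"
        then have "u \<rightarrow>\<^bsub>G\<^esub> w" using adj_sym[OF z(1)] by simp
        then have "w = P ! c" by (rule leaf_neighbour_unique[OF leaf _ u(2)])
        then show False using wV(2) u(3) length_P nth_mem[of c P] by simp
      qed
      ultimately have "far z = diam" using all zV by simp
      moreover have "hop z (P ! i) < far w" if i: "i = 0 \<or> i = diam" for i
      proof -
        have "i \<le> diam" using i by auto
        have "hop z (P ! i) \<le> hop z (P ! foot w) + hop (P ! foot w) (P ! i)"
          by (intro hop_triangle zV foot_in nth_P_in_verts \<open>i \<le> diam\<close>)
        also have "hop (P ! foot w) (P ! i) = (i - foot w) + (foot w - i)"
          using path_hop[OF vpath_P] foot \<open>i \<le> diam\<close> length_P by simp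
        finally show ?thesis
          using i hz foot unfolding far_eq[OF wV(1)] by auto
      qed
      then have "far z < far w" by (simp add: far_def[of z])
      ultimately show False using far_le_diam[OF wV(1)] by simp
    qed
    moreover have "foot w = 1 \<or> foot w = diam - 1"
    proof -
      \<comment> \<open>At height 1, eccentricity \<open>diam\<close> leaves exactly
        \<open>diam - 1\<close> steps from the foot to its farther end.\<close>
      have "1 + max (foot w) (diam - foot w) = diam"
        using all w far_eq[OF wV(1)] \<open>height w = 1\<close> by simp
      then show ?thesis using foot by (auto simp: max_def split: if_splits)
    qed
    ultimately show "w \<rightarrow>\<^bsub>G\<^esub> P ! 1 \<or> w \<rightarrow>\<^bsub>G\<^esub> P ! (diam - 1)"
      using adj_foot[OF wV(1)] by metis
  qed
next
  assume adj: "\<forall>w\<in>verts G - insert u (set P). w \<rightarrow>\<^bsub>G\<^esub> P ! 1 \<or> w \<rightarrow>\<^bsub>G\<^esub> P ! (diam - 1)"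
  show "\<forall>w\<in>verts G - insert u (set P). far w = diam"
  proof
    fix w assume w: "w \<in> verts G - insert u (set P)"
    then have wV: "w \<in> verts G" "w \<notin> set P" by auto
    have "height w = 1 \<and> (foot w = 1 \<or> foot w = diam - 1)"
      using adj w hop_foot_eq_1[OF wV diam] hop_foot_eq_1[OF wV, of "diam - 1"] by auto
    then have "diam \<le> far w"
      using far_eq[OF wV(1)] diam by auto
    then show "far w = diam" using far_le_diam[OF wV(1)] by simp
  qed
qed

text \<open>If the leaf is an end of the path, its own summand \<open>diam\<close> is the one that is missing, which is
  why the right-hand side does not depend on the position of the leaf.\<close>

lemma
  assumes "leaf G u"
  defines "N \<equiv> int (\<Sum>i\<le>diam. max i (diam - i)) + (int (card (verts G)) - int diam - 2) * int diam"
  shows sum_far_others_le: "int (\<Sum>v\<in>verts G - {u}. far v) \<le> N"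
    and sum_far_others_eq_iff: "u \<notin> set P \<Longrightarrow>
      int (\<Sum>v\<in>verts G - {u}. far v) = N \<longleftrightarrow>
      (\<forall>w\<in>verts G - insert u (set P). far w = diam)"
proof -
  let ?R = "verts G - insert u (set P)"
  have u: "u \<in> verts G" using assms(1) by (simp add: leaf_def)
  have le: "(\<Sum>v\<in>?R. far v) \<le> card ?R * diam"
    using sum_bounded_above[of ?R far diam] far_le_diam by simp
  \<comment> \<open>The gap to \<open>N\<close> is what the remaining vertices off \<open>P\<close>
    lack from the maximum \<open>diam\<close> each.\<close>
  have off: "int (\<Sum>v\<in>verts G - {u}. far v) = N - (int (card ?R * diam) - int (\<Sum>v\<in>?R. far v))"
    if "u \<notin> set P"
  proof -
    have split: "verts G - {u} = set P \<union> ?R" using set_P_subset that by auto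
    have "(\<Sum>v\<in>verts G - {u}. far v) = (\<Sum>v\<in>set P. far v) + (\<Sum>v\<in>?R. far v)"
      unfolding split by (rule sum.union_disjoint) auto
    moreover have "card (insert u (set P)) = diam + 2"
      using that card_set_P by simp
    then have "card ?R + (diam + 2) = card (verts G)"
      using card_Diff_subset[of "insert u (set P)" "verts G"] set_P_subset u
        card_mono[of "verts G" "insert u (set P)"] by simp
    then have "int (card ?R) = int (card (verts G)) - int diam - 2" by linarith
    ultimately show ?thesis
      unfolding N_def sum_far_path by simp
  qed
  show "int (\<Sum>v\<in>verts G - {u}. far v) \<le> N"
  proof (cases "u \<in> set P")
    case False
    then show ?thesis using off le by linarith
  next
    case True
    have R: "?R = verts G - set P" using True by auto
    have "(\<Sum>v\<in>verts G. far v) = (\<Sum>v\<in>set P. far v) + (\<Sum>v\<in>?R. far v)"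
      unfolding R using sum.subset_diff[OF set_P_subset finite_verts, of far] by simp
    moreover have "(\<Sum>v\<in>verts G. far v) = diam + (\<Sum>v\<in>verts G - {u}. far v)"
      using sum.remove[OF finite_verts u, of far] far_end_of_leaf[OF assms(1) True] by simp
    moreover have "card ?R + (diam + 1) = card (verts G)"
      unfolding R using card_Diff_subset[OF _ set_P_subset] card_set_P diam_less_card by simp
    then have "int (card ?R) = int (card (verts G)) - int diam - 1" by linarith
    then have "int (card ?R * diam) = (int (card (verts G)) - int diam - 1) * int diam" by simp
    \<comment> \<open>Compared with a leaf off \<open>P\<close>, one more vertex counts off
      \<open>P\<close>, and the missing summand \<open>diam\<close> makes up for it.\<close>
    moreover have "N = int (\<Sum>i\<le>diam. max i (diam - i)) +
        (int (card (verts G)) - int diam - 1) * int diam - int diam"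
      unfolding N_def by (simp add: algebra_simps del: of_nat_sum)
    ultimately show ?thesis
      using le unfolding sum_far_path by linarith
  qed
  show "int (\<Sum>v\<in>verts G - {u}. far v) = N \<longleftrightarrow> (\<forall>w\<in>?R. far w = diam)" if "u \<notin> set P"
  proof -
    have "int (\<Sum>v\<in>verts G - {u}. far v) = N \<longleftrightarrow> (\<Sum>v\<in>?R. far v) = (\<Sum>v\<in>?R. diam)"
      unfolding off[OF that] by (auto simp del: of_nat_sum of_nat_mult)
    also have "\<dots> \<longleftrightarrow> (\<forall>w\<in>?R. far w = diam)"
      using sum_mono_inv[of far ?R "\<lambda>_. diam"] far_le_diam by auto
    finally show ?thesis .
  qed
qed

lemma total_ecc_eq: "total_ecc G = real (\<Sum>v\<in>verts G. far v)"
  unfolding total_ecc_def by (simp add: ecc_eq_far)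

section \<open>The ratio for a leaf\<close>

text \<open>Splitting off the summand of the leaf, the ratio is \<open>1 + M / far u\<close>, so
  \<open>ratio_bound\<close> applies with \<open>B - 1\<close>. Its equality conditions become the
  length of \<open>P\<close>, the place of the leaf (\<open>far_half_iff\<close>) and that of the
  other vertices (\<open>off_path_far_diam_iff\<close>).\<close>

lemma
  assumes leaf: "leaf G u" and n: "card (verts G) = n" "4 \<le> n"
    and x: "x * (x - 1) < 2 * n - 1" "2 * n - 1 < x * (x + 1)"
  defines "B \<equiv> 2 * real n + 1 - real x - (2 * real n - 1) / real x"
  shows ecc_ratio_le: "total_ecc G / ecc G u \<le> B"
    and ecc_ratio_eq_iff: "total_ecc G / ecc G u = B \<longleftrightarrow>
      length P = 2 * x - 1 \<and> u \<notin> set P \<and> u \<rightarrow>\<^bsub>G\<^esub> P ! (x - 1) \<and>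
      (\<forall>w\<in>verts G. w \<notin> set P \<longrightarrow> w \<noteq> u \<longrightarrow>
        w \<rightarrow>\<^bsub>G\<^esub> P ! (2 - 1) \<or> w \<rightarrow>\<^bsub>G\<^esub> P ! ((2 * x - 2) - 1))" (is "_ \<longleftrightarrow> ?R")
proof -
  define M where "M = int (\<Sum>v\<in>verts G - {u}. far v)"
  define N where "N = int (\<Sum>i\<le>diam. max i (diam - i)) + (int n - int diam - 2) * int diam"
  have u: "u \<in> verts G" using leaf by (simp add: leaf_def)
  have D: "2 \<le> diam" "diam < n"
    using diam_ge_2 diam_less_card n by auto
  have e: "diam + 2 \<le> 2 * far u" by (rule far_leaf_ge[OF leaf D(1)])
  have M: "M \<le> N"
    using sum_far_others_le[OF leaf] n(1) unfolding M_def N_def by simp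
  \<comment> \<open>From \<open>n \<ge> 4\<close> the number \<open>2 * n - 1\<close> is at least 7,
    too large for the window of \<open>x = 2\<close>.\<close>
  have x3: "3 \<le> x"
  proof (rule ccontr)
    assume "\<not> 3 \<le> x"
    then have "x * (x + 1) \<le> 2 * 3" by (intro mult_le_mono) auto
    then show False using x(2) n(2) by linarith
  qed
  have "(\<Sum>v\<in>verts G. far v) = far u + (\<Sum>v\<in>verts G - {u}. far v)"
    by (rule sum.remove[OF finite_verts u])
  then have "total_ecc G = real (far u) + real_of_int M"
    unfolding total_ecc_eq M_def by simp
  moreover have "0 < real (far u)" using e by simp
  ultimately have ratio: "total_ecc G / ecc G u \<le> B \<longleftrightarrow> real_of_int M \<le> (B - 1) * real (far u)"
      "total_ecc G / ecc G u = B \<longleftrightarrow> real_of_int M = (B - 1) * real (far u)"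
    unfolding ecc_eq_far[OF u] by (auto simp: field_simps)
  have B: "B - 1 = 2 * real n - real x - (2 * real n - 1) / real x"
    by (simp add: B_def)
  note bound = ratio_bound[OF D e x M[unfolded N_def], folded B]
    and bound_eq = ratio_bound_eq_iff[OF D e x M[unfolded N_def], folded B N_def]
  show "total_ecc G / ecc G u \<le> B" using ratio(1) bound by blast
  have len: "length P = 2 * x - 1 \<longleftrightarrow> diam + 2 = 2 * x"
    using length_P x3 by linarith
  have "diam + 2 = 2 * x \<and> far u = x \<and> M = N \<longleftrightarrow> ?R" if dx: "diam + 2 = 2 * x"
  proof -
    have half: "diam = 2 * (x - 1)" and mid: "x - 1 \<le> diam" "1 \<le> diam"
      and idx: "2 - 1 = (1::nat)" "2 * x - 2 - 1 = diam - 1"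
      using dx x3 by auto
    \<comment> \<open>A leaf on \<open>P\<close> has eccentricity \<open>2 * x - 2\<close>, which
      exceeds \<open>x\<close> because \<open>x \<ge> 3\<close>.\<close>
    have off: "far u = x \<Longrightarrow> u \<notin> set P"
      using far_end_of_leaf[OF leaf] dx x3 by auto
    have center: "u \<notin> set P \<Longrightarrow> far u = x \<longleftrightarrow> u \<rightarrow>\<^bsub>G\<^esub> P ! (x - 1)"
      using far_half_iff[OF u _ half] x3 by simp
    have MN: "u \<notin> set P \<Longrightarrow> M = N \<longleftrightarrow> (\<forall>w\<in>verts G - insert u (set P). far w = diam)"
      using sum_far_others_eq_iff[OF leaf] n(1) unfolding M_def N_def by blast
    have "?R \<longleftrightarrow> u \<notin> set P \<and> u \<rightarrow>\<^bsub>G\<^esub> P ! (x - 1) \<and>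
        (\<forall>w\<in>verts G - insert u (set P). w \<rightarrow>\<^bsub>G\<^esub> P ! 1 \<or> w \<rightarrow>\<^bsub>G\<^esub> P ! (diam - 1))"
      unfolding len idx using dx by blast
    also have "\<dots> \<longleftrightarrow> u \<notin> set P \<and> far u = x \<and> M = N"
      using center MN off_path_far_diam_iff[OF leaf _ _ mid] by blast
    finally show ?thesis using off dx by blast
  qed
  then show "total_ecc G / ecc G u = B \<longleftrightarrow> ?R"
    unfolding ratio(2) bound_eq using len by blast
qed

end

context undirected_tree_graph
begin

text \<open>The characterisation holds for every longest path: one such path gives the forward
  direction, and the path inside \<open>extremal_config\<close> gives the converse.\<close>

lemma leaf_ecc_ratio:
  assumes "leaf G u" "card (verts G) = n" "4 \<le> n"
    and "x * (x - 1) < 2 * n - 1" "2 * n - 1 < x * (x + 1)"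
  defines "B \<equiv> 2 * real n + 1 - real x - (2 * real n - 1) / real x"
  shows "total_ecc G / ecc G u \<le> B \<and> (total_ecc G / ecc G u = B \<longleftrightarrow> extremal_config G u x)"
proof -
  have path: "diametral_path G P" if "longest_path G P" for P
    using that undirected_tree_graph_axioms
    by (simp add: diametral_path_def diametral_path_axioms_def)
  note le = diametral_path.ecc_ratio_le[OF path assms(1-5), folded B_def]
    and eq_iff = diametral_path.ecc_ratio_eq_iff[OF path assms(1-5), folded B_def]
  obtain P where P: "longest_path G P" using ex_longest_path by blast
  have "total_ecc G / ecc G u = B \<longleftrightarrow> extremal_config G u x"
  proof
    assume "total_ecc G / ecc G u = B"
    then show "extremal_config G u x"
      unfolding extremal_config_def using P eq_iff[OF P] by blast
  next
    assume "extremal_config G u x"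
    then show "total_ecc G / ecc G u = B"
      unfolding extremal_config_def using eq_iff by blast
  qed
  then show ?thesis using le[OF P] by blast
qed

end

section \<open>The two ranges of the remainder\<close>

lemma undirected_tree_graph_iff: "undirected_tree T \<longleftrightarrow> undirected_tree_graph T"
  by (auto simp: undirected_tree_def undirected_tree_graph_def undirected_tree_graph_axioms_def not_le)

theorem theorem2p3:
  fixes T :: "('a, 'b) pre_digraph" and u :: 'a and n k i :: nat
  assumes "undirected_tree T"
    and "card (verts T) = n"
    and "n \<ge> 8"
    and "i \<le> 2 * k"
    and "2 * n - 1 = k ^ 2 + i"
    and "leaf T u"
  shows
    "total_ecc T / ecc T u \<le> (if i \<le> k then bound_k n k i else bound_Suc_k n k i) \<and>
     (total_ecc T / ecc T u = (if i \<le> k then bound_k n k i else bound_Suc_k n k i) \<longleftrightarrow>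
        (\<exists>x. (i \<le> k \<and> x = k \<or> k \<le> i \<and> x = k + 1) \<and> extremal_config T u x)) \<and>
     (i = k \<longrightarrow> bound_k n k i = bound_Suc_k n k i \<and>
        (\<forall>x\<in>{k, k + 1}.
           (extremal_config T u x \<longrightarrow> total_ecc T / ecc T u = bound_k n k i) \<and>
           (\<exists>(T' :: (nat, nat \<times> nat) pre_digraph) u'.
              undirected_tree T' \<and> card (verts T') = n \<and> leaf T' u' \<and>
              extremal_config T' u' x \<and> total_ecc T' / ecc T' u' = bound_k n k i)))"
proof -
  interpret undirected_tree_graph T
    using assms(1) by (simp add: undirected_tree_graph_iff)
  let ?r = "total_ecc T / ecc T u"
  have n: "4 \<le> n" using assms(3) by simp
  have m: "2 * n - 1 = k * k + i" using assms(5) by (simp add: power2_eq_square)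
  have k: "0 < k" using m assms(3,4) by (cases k) auto
  \<comment> \<open>At \<open>i = k\<close> the odd number \<open>2 * n - 1\<close> would be a
    product of consecutive integers. This settles the conjunct for \<open>i = k\<close> and leaves
    one choice of \<open>x\<close> in each range.\<close>
  have "i \<noteq> k"
  proof
    assume "i = k"
    then have "2 * n - 1 = k * (k + 1)" using m by simp
    then have "even (2 * n - 1)" by simp
    then show False using assms(3) by simp
  qed
  have real_m: "2 * real n - 1 = real k * real k + real i"
    using arg_cong[OF m, of real] assms(3) by simp
  show ?thesis
  proof (cases "i \<le> k")
    case True
    then have "i < k" using \<open>i \<noteq> k\<close> by simp
    have lo: "k * (k - 1) < 2 * n - 1"
      unfolding m using k \<open>i < k\<close> by (cases k) auto
    have hi: "2 * n - 1 < k * (k + 1)"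
      unfolding m using \<open>i < k\<close> by simp
    \<comment> \<open>The quotient \<open>(k * k + i) / k\<close> is
      \<open>k + i / k\<close>.\<close>
    have "bound_k n k i = 2 * real n + 1 - real k - (2 * real n - 1) / real k"
      unfolding bound_k_def real_m using k by (simp add: field_simps)
    then show ?thesis
      using leaf_ecc_ratio[OF assms(6,2) n lo hi] \<open>i < k\<close> by auto
  next
    case False
    \<comment> \<open>Beyond \<open>k\<close> the value \<open>k * k + i\<close> has passed
      \<open>k * (k + 1)\<close> and lies in the window of \<open>k + 1\<close>.\<close>
    have lo: "(k + 1) * (k + 1 - 1) < 2 * n - 1"
      unfolding m using False by simp
    have hi: "2 * n - 1 < (k + 1) * (k + 1 + 1)"
      unfolding m using assms(4) by simp
    \<comment> \<open>Here \<open>k * k + i = (k - 1) * (k + 1) + (i + 1)\<close> produces the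
      fraction with denominator \<open>k + 1\<close>.\<close>
    have "bound_Suc_k n k i = 2 * real n + 1 - real (k + 1) - (2 * real n - 1) / real (k + 1)"
      unfolding bound_Suc_k_def real_m using k by (simp add: field_simps)
    then show ?thesis
      using leaf_ecc_ratio[OF assms(6,2) n lo hi] False by auto
  qed
qed

end
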